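(* Let $d\in\mathbb{N}$ and $r=\lceil\frac{d+1}{2}\rceil$. A subset $B\subseteq[d+1]$ is a basis of the Dehn--Sommerville matroid $DS_d$ if and only if there is a routing in the digraph $\mathbf{DS}_d$ from the set of sources $\{\mathbf{1},\dots,\mathbf{r}\}$ to the set of sinks $B$.
   Context: Binomial coefficients satisfy $\binom{a}{b}=0$ if $b<0$ or $b>a$. The Dehn--Sommerville matrix $M_d$ is the $(\lfloor d/2\rfloor+1)\times(d+1)$ rational matrix with rows indexed by $0\le i\le\lfloor d/2\rfloor$, columns indexed by $0\le j\le d$, and entries $(M_d)_{ij}=\binom{d+1-i}{d+1-j}-\binom{i}{d+1-j}$. Relabel the columns $1,\dots,d+1$ (column $j$ receiving label $j+1$). The Dehn--Sommerville matroid $DS_d$ is the matroid on ground set $[d+1]$ whose bases are the sets of column labels $B$ with $|B|=\lfloor d/2\rfloor+1=r$ such that the corresponding maximal minor of $M_d$ is nonzero. The digraph $\mathbf{DS}_d$ has vertex set $\{(-a,b)\in\mathbb{Z}^2: 0\le a\le b,\ a+b\le d\}$, with an edge $(-a,b)\to(-a+1,b)$ (directed east) and an edge $(-a,b)\to(-a,b+1)$ (directed north) whenever both endpoints are vertices. The sources are $\mathbf{k}=(-(k-1),k-1)$ for $k=1,\dots,r$, and the sinks are the vertices $(0,j-1)$, labeled $j$, for $j=1,\dots,d+1$. A routing from the sources $\{\mathbf{1},\dots,\mathbf{r}\}$ to a sink set $B$ with $|B|=r$ is a collection of pairwise vertex-disjoint directed paths, one starting at each source, whose set of endpoints is exactly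 the set of sinks labeled by $B$. *)

theory Defs
  imports
    "Jordan_Normal_Form.DL_Submatrix"
    "Jordan_Normal_Form.Determinant"
    "Graph_Theory.Graph_Theory"
begin

text \<open>
  For \<open>i \<le> d div 2\<close> and \<open>j \<le> d\<close> the subtractions below are genuine
  subtractions of natural numbers, and \<open>choose\<close> is 0 when its lower
  argument exceeds the upper one.
\<close>

definition DS_matrix :: "nat \<Rightarrow> rat mat" where
  "DS_matrix d = mat (d div 2 + 1) (d + 1)
     (\<lambda>(i, j). of_nat ((d + 1 - i) choose (d + 1 - j)) - of_nat (i choose (d + 1 - j)))"

text \<open>
  Bases of the Dehn--Sommerville matroid on the ground set \<open>{1..d + 1}\<close>.
  Column \<open>j\<close> (counted from 0) carries the label \<open>j + 1\<close>.
\<close>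

definition DS_bases :: "nat \<Rightarrow> nat set set" where
  "DS_bases d = {B. B \<subseteq> {1..d + 1} \<and> card B = d div 2 + 1 \<and>
     det (submatrix (DS_matrix d) UNIV {j. j + 1 \<in> B}) \<noteq> 0}"

definition DS_verts :: "nat \<Rightarrow> (int \<times> int) set" where
  "DS_verts d = {(- a, b) |a b. 0 \<le> a \<and> a \<le> b \<and> a + b \<le> int d}"

definition DS_arcs :: "nat \<Rightarrow> (int \<times> int) rel" where
  "DS_arcs d =
     {((- a, b), (- a + 1, b)) |a b. (- a, b) \<in> DS_verts d \<and> (- a + 1, b) \<in> DS_verts d} \<union>
     {((- a, b), (- a, b + 1)) |a b. (- a, b) \<in> DS_verts d \<and> (- a, b + 1) \<in> DS_verts d}"

definition DS_digraph :: "nat \<Rightarrow> (int \<times> int) pair_pre_digraph" where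
  "DS_digraph d = \<lparr>pverts = DS_verts d, parcs = DS_arcs d\<rparr>"

definition DS_source :: "nat \<Rightarrow> int \<times> int" where
  "DS_source k = (- (int k - 1), int k - 1)"

definition DS_sink :: "nat \<Rightarrow> int \<times> int" where
  "DS_sink j = (0, int j - 1)"

text \<open>
  A routing from \<open>S\<close> to \<open>T\<close> assigns to each source \<open>s \<in> S\<close> a directed path
  \<open>P s\<close>, given by its vertices (a single vertex is allowed). A path may pass
  through other elements of \<open>S\<close> or \<open>T\<close>, subject to disjointness. As the paths are
  disjoint, their endpoints are distinct, so \<open>S\<close> and \<open>T\<close> are equinumerous.
\<close>

definition routing ::
  "('a, 'b) pre_digraph \<Rightarrow> 'a set \<Rightarrow> 'a set \<Rightarrow> ('a \<Rightarrow> 'a vwalk) \<Rightarrow> bool" where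
  "routing G S T P \<longleftrightarrow>
     (\<forall>s\<in>S. vpath (P s) G \<and> hd (P s) = s) \<and>
     (\<forall>s\<in>S. \<forall>s'\<in>S. s \<noteq> s' \<longrightarrow> set (P s) \<inter> set (P s') = {}) \<and>
     (\<lambda>s. last (P s)) ` S = T"

end

theory Submission
  imports Defs
begin

text \<open>
  Both conditions say that \<open>B\<close> has \<open>r\<close> elements and that the \<open>k\<close>-th smallest column index \<open>c k\<close>
  (all counted from 0) satisfies \<open>c k + 2 * (r - 1 - k) \<le> d\<close>.

  Reading row \<open>i\<close> of \<open>M_d\<close> as a polynomial in \<open>x = y - 1\<close> gives \<open>y ^ (d + 1 - i) - y ^ i\<close>, so the
  rows span the antisymmetric polynomials in \<open>y\<close>. Another basis of that space consists of the
  \<open>(y - 1) ^ (2 * k + 1) * (y + 1) ^ (d - 2 * k) = x ^ (2 * k + 1) * (x + 2) ^ (d - 2 * k)\<close>. Up to the column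
  factors \<open>2 ^ j\<close>, \<open>M_d\<close> is therefore row equivalent to the matrix \<open>(d - 2 * k choose j)\<close>. The
  minors of Pascal's triangle with increasing rows \<open>m\<close> and columns \<open>c\<close> are nonnegative, and they are
  nonzero exactly if \<open>c k \<le> m k\<close> for all \<open>k\<close>.

  In the digraph, the sinks of a routing are ordered like its sources. When the \<open>k\<close>-th path reaches
  its sink, the \<open>r - 1 - k\<close> later ones are in distinct columns further to the west, which forces the
  inequality through \<open>a + b \<le> d\<close>. Conversely, let all paths move simultaneously, going east
  exactly at those times that are column indices of \<open>B\<close>; they form a routing.
\<close>

section \<open>Minors of the Pascal matrix\<close>

lemma det_mat_Leibniz:
  fixes f :: "nat \<Rightarrow> nat \<Rightarrow> 'a :: comm_ring_1"
  shows "det (mat n n (\<lambda>(i, j). f i j)) =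
    (\<Sum>p | p permutes {0..<n}. signof p * (\<Prod>i = 0..<n. f i (p i)))"
proof -
  have "(\<Prod>i = 0..<n. mat n n (\<lambda>(i, j). f i j) $$ (i, p i)) = (\<Prod>i = 0..<n. f i (p i))"
    if "p permutes {0..<n}" for p
    using permutes_in_image[OF that] by (intro prod.cong) auto
  then show ?thesis
    by (subst det_def') (auto intro!: sum.cong)
qed

lemma det_mat_scale:
  fixes f :: "nat \<Rightarrow> nat \<Rightarrow> 'a :: comm_ring_1"
  shows "det (mat n n (\<lambda>(i, j). a i * f i j * b j)) =
    (\<Prod>i<n. a i) * (\<Prod>j<n. b j) * det (mat n n (\<lambda>(i, j). f i j))"
proof -
  have "(\<Prod>i = 0..<n. a i * f i (p i) * b (p i)) =
      (\<Prod>i<n. a i) * (\<Prod>j<n. b j) * (\<Prod>i = 0..<n. f i (p i))" if "p permutes {0..<n}" for p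
    using prod.permute[OF that, of b]
    by (simp add: prod.distrib atLeast0LessThan mult_ac)
  then show ?thesis
    by (simp add: det_mat_Leibniz sum_distrib_left mult_ac)
qed

text \<open>Multilinearity in the rows: multiplying out each Leibniz term picks one summand per row,
  and the functions in \<open>PiE {0..<n} T\<close> are these choices.\<close>

lemma det_mat_rows_sum:
  fixes f :: "'b \<Rightarrow> nat \<Rightarrow> 'a :: comm_ring_1"
  assumes "\<And>i. i < n \<Longrightarrow> finite (T i)"
  shows "det (mat n n (\<lambda>(i, j). \<Sum>t\<in>T i. f t j)) =
    (\<Sum>\<tau>\<in>PiE {0..<n} T. det (mat n n (\<lambda>(i, j). f (\<tau> i) j)))"
proof -
  have "(\<Prod>i = 0..<n. \<Sum>t\<in>T i. f t (p i)) = (\<Sum>\<tau>\<in>PiE {0..<n} T. \<Prod>i = 0..<n. f (\<tau> i) (p i))" for p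
    using assms by (intro prod_sum_PiE) auto
  then show ?thesis
    by (simp add: det_mat_Leibniz[of n "\<lambda>i j. \<Sum>t\<in>T i. f t j"] det_mat_Leibniz[of n "\<lambda>i j. f (_ i) j"] sum_distrib_left)
      (rule sum.swap)
qed

text \<open>Taking row differences is left multiplication by the lower bidiagonal matrix
  \<open>L\<close>, whose diagonal consists of ones.\<close>

lemma det_mat_row_differences:
  fixes f :: "nat \<Rightarrow> nat \<Rightarrow> 'a :: idom"
  shows "det (mat n n (\<lambda>(i, j). if i = 0 then f 0 j else f i j - f (i - 1) j)) =
    det (mat n n (\<lambda>(i, j). f i j))"
proof -
  define L where "L = mat n n (\<lambda>(i, k). if k = i then 1 else if Suc k = i then - 1 else (0::'a))"
  define F where "F = mat n n (\<lambda>(i, j). f i j)"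
  have "det L = prod_list (diag_mat L)"
    by (rule det_lower_triangular[of n]) (auto simp: L_def)
  also have "diag_mat L = replicate n 1"
    by (auto simp: diag_mat_def L_def intro!: nth_equalityI)
  finally have detL: "det L = 1" by simp
  have "mat n n (\<lambda>(i, j). if i = 0 then f 0 j else f i j - f (i - 1) j) = L * F"
  proof (rule eq_matI)
    fix i j assume "i < dim_row (L * F)" "j < dim_col (L * F)"
    then have ij: "i < n" "j < n" by (auto simp: L_def F_def)
    have "(L * F) $$ (i, j) = (\<Sum>k = 0..<n. (if k = i then f i j else 0) +
        (if Suc k = i then - f k j else 0))"
      using ij by (auto simp: L_def F_def scalar_prod_def intro!: sum.cong)
    also have "\<dots> = f i j + (\<Sum>k = 0..<n. if Suc k = i then - f k j else 0)"
      using ij by (simp add: sum.distrib)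
    also have "(\<Sum>k = 0..<n. if Suc k = i then - f k j else 0) = (if i = 0 then 0 else - f (i - 1) j)"
      using ij by (cases i) auto
    finally show "mat n n (\<lambda>(i, j). if i = 0 then f 0 j else f i j - f (i - 1) j) $$ (i, j) = (L * F) $$ (i, j)"
      using ij by auto
  qed (auto simp: L_def F_def)
  then show ?thesis
    using det_mult[of L n F] detL by (simp add: L_def F_def)
qed

text \<open>Pascal's rule, telescoped. It turns the difference of two rows of Pascal's triangle into
  a sum of rows with the lower index reduced by one.\<close>

lemma sum_choose_telescope:
  assumes "a \<le> b"
  shows "(\<Sum>t = a..<b. of_nat (t choose k)) =
    (of_nat (b choose Suc k) - of_nat (a choose Suc k) :: 'a :: comm_ring_1)"
  using assms by (induction b rule: dec_induct) (auto simp: algebra_simps)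

text \<open>If \<open>c 0 = 0\<close>, then row differences are sums of shorter rows of the same kind over consecutive
  intervals, and by multilinearity the minor is a sum of smaller minors. Otherwise
  \<open>(m choose c) = (m / c) * (m - 1 choose c - 1)\<close> lowers \<open>c 0\<close>.\<close>

lemma det_binomial_sign:
  fixes m c :: "nat \<Rightarrow> nat"
  defines "D \<equiv> \<lambda>n m c. det (mat n n (\<lambda>(i, j). of_nat (m i choose c j) :: 'a :: linordered_field))"
  assumes "\<And>i j. i < j \<Longrightarrow> j < n \<Longrightarrow> m i < m j"
    and "\<And>i j. i < j \<Longrightarrow> j < n \<Longrightarrow> c i < c j"
  shows "0 \<le> D n m c \<and> ((\<forall>k<n. c k \<le> m k) \<longrightarrow> 0 < D n m c)"
  using assms(2-)
proof (induction n arbitrary: m c)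
  case 0
  then show ?case by (simp add: D_def)
next
  case (Suc n)
  from Suc.prems show ?case
  proof (induction "c 0" arbitrary: m c)
    case 0
    define T where "T i = {m i..<m (Suc i)}" for i
    define c' where "c' j = c (Suc j) - 1" for j
    define A where "A = mat (Suc n) (Suc n) (\<lambda>(i, j). if i = 0 then of_nat (m 0 choose c j)
      else of_nat (m i choose c j) - of_nat (m (i - 1) choose c j) :: 'a)"
    have c: "c (Suc j) = Suc (c' j)" if "j < n" for j
      using 0(3)[of 0 "Suc j"] that by (simp add: c'_def)
    \<comment> \<open>Since \<open>c 0 = 0\<close>, the first column is all ones before and the
      first unit vector after taking differences, so Laplace expansion leaves a single
      minor.\<close>
    have "D (Suc n) m c = det A"
      unfolding D_def A_def by (subst det_mat_row_differences[symmetric]) simp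
    also have "\<dots> = (\<Sum>i<Suc n. A $$ (i, 0) * cofactor A i 0)"
      by (rule laplace_expansion_column) (auto simp: A_def)
    also have "\<dots> = (\<Sum>i<Suc n. if i = 0 then cofactor A 0 0 else 0)"
      using 0(1) by (intro sum.cong) (auto simp: A_def)
    also have "\<dots> = det (mat_delete A 0 0)"
      by (simp add: cofactor_def)
    also have "mat_delete A 0 0 = mat n n (\<lambda>(i, j). \<Sum>t\<in>T i. of_nat (t choose c' j))"
    proof (rule eq_matI)
      fix i j assume "i < dim_row (mat n n (\<lambda>(i, j). \<Sum>t\<in>T i. of_nat (t choose c' j) :: 'a))"
        "j < dim_col (mat n n (\<lambda>(i, j). \<Sum>t\<in>T i. of_nat (t choose c' j) :: 'a))"
      then have ij: "i < n" "j < n" by auto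
      then show "mat_delete A 0 0 $$ (i, j) = mat n n (\<lambda>(i, j). \<Sum>t\<in>T i. of_nat (t choose c' j)) $$ (i, j)"
        using 0(2)[of i "Suc i"]
        by (simp add: mat_delete_def A_def T_def sum_choose_telescope c del: binomial_Suc_Suc)
    qed (auto simp: A_def)
    also have "det \<dots> = (\<Sum>\<tau>\<in>PiE {0..<n} T. D n \<tau> c')"
      unfolding D_def by (rule det_mat_rows_sum) (auto simp: T_def)
    finally have D: "D (Suc n) m c = (\<Sum>\<tau>\<in>PiE {0..<n} T. D n \<tau> c')" .
    \<comment> \<open>The intervals \<open>T i\<close> are consecutive, so every choice of one row
      from each is strictly increasing and the hypothesis for size \<open>n\<close> applies.\<close>
    have IH: "0 \<le> D n \<tau> c' \<and> ((\<forall>k<n. c' k \<le> \<tau> k) \<longrightarrow> 0 < D n \<tau> c')" if \<tau>: "\<tau> \<in> PiE {0..<n} T" for \<tau>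
    proof (rule Suc.IH)
      fix i j assume ij: "i < j" "j < n"
      then have "\<tau> i < m (Suc i)" "m j \<le> \<tau> j"
        using PiE_mem[OF \<tau>, of i] PiE_mem[OF \<tau>, of j] by (auto simp: T_def)
      moreover have "m (Suc i) \<le> m j"
        using 0(2)[of "Suc i" j] ij by (cases "Suc i = j") auto
      ultimately show "\<tau> i < \<tau> j" by simp
      show "c' i < c' j" using 0(3)[of "Suc i" "Suc j"] c[of i] c[of j] ij by simp
    qed
    have fin: "finite (PiE {0..<n} T)"
      by (intro finite_PiE) (auto simp: T_def)
    have pos: "0 < D (Suc n) m c" if cm: "\<forall>k<Suc n. c k \<le> m k"
    proof -
      \<comment> \<open>The largest row of each interval preserves the bounds, as both sides drop by
        one. This one positive summand suffices, since none is negative.\<close>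
      define \<tau> where "\<tau> = restrict (\<lambda>i. m (Suc i) - 1) {0..<n}"
      have \<tau>: "\<tau> \<in> PiE {0..<n} T"
      proof (rule PiE_I)
        fix i assume "i \<in> {0..<n}"
        then show "\<tau> i \<in> T i" using 0(2)[of i "Suc i"] by (auto simp: \<tau>_def T_def)
      qed (auto simp: \<tau>_def)
      have "c' k \<le> \<tau> k" if "k < n" for k
        using cm[rule_format, of "Suc k"] c[OF that] that by (simp add: \<tau>_def)
      with IH[OF \<tau>] have "0 < D n \<tau> c'" by blast
      with \<tau> fin show ?thesis
        unfolding D using IH by (intro sum_pos2[where i = \<tau>]) auto
    qed
    show ?case using pos IH by (auto simp: D intro: sum_nonneg)
  next
    case (Suc s)
    have cpos: "0 < c j" if "j < Suc n" for j
      using Suc.prems(2)[of 0 j] Suc.hyps(2) that by (cases j) auto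
    show ?case
    proof (cases "m 0 = 0")
      \<comment> \<open>The first row vanishes because every \<open>c j\<close> is positive, and
        \<open>c 0 \<le> m 0\<close> fails.\<close>
      case True
      have "D (Suc n) m c = 0"
        unfolding D_def det_mat_Leibniz
      proof (rule sum.neutral, rule ballI)
        fix p assume "p \<in> {p. p permutes {0..<Suc n}}"
        then have "p 0 < Suc n" using permutes_in_image[of p "{0..<Suc n}" 0] by simp
        then have "m 0 choose c (p 0) = 0" using True cpos[of "p 0"] by simp
        then have "(\<Prod>i = 0..<Suc n. of_nat (m i choose c (p i))) = (0::'a)"
          by (intro prod_zero) (auto intro!: bexI[of _ 0])
        then show "signof p * (\<Prod>i = 0..<Suc n. of_nat (m i choose c (p i))) = (0::'a)" by simp
      qed
      then show ?thesis using True cpos[of 0] by force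
    next
      case False
      have mpos: "0 < m i" if "i < Suc n" for i
        using Suc.prems(1)[of 0 i] False that by (cases i) auto
      define m' c' where "m' i = m i - 1" and "c' i = c i - 1" for i
      have eq: "of_nat (m i choose c j) = (of_nat (m i) * of_nat (m' i choose c' j) * inverse (of_nat (c j)) :: 'a)"
        if "i < Suc n" "j < Suc n" for i j
      proof -
        have "c j * (m i choose c j) = m i * (m' i choose c' j)"
          using mpos[OF that(1)] cpos[OF that(2)]
          by (cases "m i"; cases "c j") (auto simp: m'_def c'_def Suc_times_binomial simp del: binomial_Suc_Suc mult_Suc)
        from arg_cong[OF this, of "of_nat :: nat \<Rightarrow> 'a"] cpos[OF that(2)]
        show ?thesis by (simp add: field_simps)
      qed
      have "mat (Suc n) (Suc n) (\<lambda>(i, j). of_nat (m i choose c j) :: 'a) =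
        mat (Suc n) (Suc n) (\<lambda>(i, j). of_nat (m i) * of_nat (m' i choose c' j) * inverse (of_nat (c j)))"
        by (rule eq_matI) (simp_all add: eq)
      then have D: "D (Suc n) m c =
        (\<Prod>i<Suc n. of_nat (m i)) * (\<Prod>j<Suc n. inverse (of_nat (c j))) * D (Suc n) m' c'"
        unfolding D_def by (simp only: det_mat_scale)
      have "0 \<le> D (Suc n) m' c' \<and> ((\<forall>k<Suc n. c' k \<le> m' k) \<longrightarrow> 0 < D (Suc n) m' c')"
      proof (rule Suc.hyps(1))
        show "s = c' 0" using Suc.hyps(2) by (simp add: c'_def)
        show "m' i < m' j" if "i < j" "j < Suc n" for i j
          using Suc.prems(1)[OF that] mpos[of i] mpos[of j] that by (simp add: m'_def)
        show "c' i < c' j" if "i < j" "j < Suc n" for i j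
          using Suc.prems(2)[OF that] cpos[of i] cpos[of j] that by (simp add: c'_def)
      qed
      moreover have "0 < (\<Prod>i<Suc n. of_nat (m i) :: 'a)" "0 < (\<Prod>j<Suc n. inverse (of_nat (c j)) :: 'a)"
        by (rule prod_pos, use mpos cpos in force)+
      moreover have "c' k \<le> m' k" if "c k \<le> m k" for k
        using that by (simp add: m'_def c'_def)
      ultimately show ?thesis
        by (metis D mult_nonneg_nonneg mult_pos_pos less_imp_le)
    qed
  qed
qed

text \<open>Rows up to \<open>k\<close> vanish in all columns from \<open>k\<close> on. By
  pigeonhole, a permutation cannot send these \<open>k + 1\<close> rows into the first
  \<open>k\<close> columns, so each Leibniz term has a zero factor.\<close>

lemma det_binomial_eq_0:
  assumes "\<And>i j. i < j \<Longrightarrow> j < n \<Longrightarrow> m i < m j"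
    and "\<And>i j. i < j \<Longrightarrow> j < n \<Longrightarrow> c i < c j"
    and "k < n" and "m k < c k"
  shows "det (mat n n (\<lambda>(i, j). of_nat (m i choose c j) :: 'a :: comm_ring_1)) = 0"
  unfolding det_mat_Leibniz
proof (rule sum.neutral, rule ballI)
  fix p assume "p \<in> {p. p permutes {0..<n}}"
  then have p: "p permutes {0..<n}" by simp
  have "\<not> p ` {..k} \<subseteq> {..<k}"
    using card_mono[of "{..<k}" "p ` {..k}"] card_image[OF inj_on_subset[OF permutes_inj[OF p]], of "{..k}"]
    by auto
  then obtain i where i: "i \<le> k" "k \<le> p i" by force
  have "p i < n" using permutes_in_image[OF p, of i] i(1) assms(3) by simp
  have "m i \<le> m k" using assms(1)[of i k] assms(3) i by (cases "i = k") auto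
  moreover have "c k \<le> c (p i)" using assms(2)[of k "p i"] \<open>p i < n\<close> i by (cases "p i = k") auto
  ultimately have "m i choose c (p i) = 0" using assms(4) by simp
  then have "(\<Prod>i = 0..<n. of_nat (m i choose c (p i))) = (0::'a)"
    using i(1) assms(3) by (intro prod_zero bexI[of _ i]) (auto simp: binomial_eq_0)
  then show "signof p * (\<Prod>i = 0..<n. of_nat (m i choose c (p i))) = (0::'a)" by simp
qed

lemma det_binomial_nonzero_iff:
  assumes "\<And>i j. i < j \<Longrightarrow> j < n \<Longrightarrow> m i < m j"
    and "\<And>i j. i < j \<Longrightarrow> j < n \<Longrightarrow> c i < c j"
  shows "det (mat n n (\<lambda>(i, j). of_nat (m i choose c j) :: 'a :: linordered_field)) \<noteq> 0 \<longleftrightarrow>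
    (\<forall>k<n. c k \<le> m k)"
  using det_binomial_sign[where 'a = 'a, of n m c] det_binomial_eq_0[where 'a = 'a, of n m c] assms
  by (metis not_le less_irrefl)

section \<open>Bases of the Dehn--Sommerville matroid\<close>

definition antisym_poly :: "nat \<Rightarrow> nat \<Rightarrow> rat poly" where
  "antisym_poly d k = [:-1, 1:] ^ (2 * k + 1) * [:1, 1:] ^ (d - 2 * k)"

lemma degree_antisym_poly:
  assumes "2 * k \<le> d"
  shows "degree (antisym_poly d k) = d + 1"
  using assms by (simp add: antisym_poly_def degree_mult_eq degree_power_eq del: power_Suc)

text \<open>Reversing coefficients fixes \<open>y + 1\<close> and negates \<open>y - 1\<close>,
  which occurs to an odd power.\<close>

lemma coeff_antisym_poly:
  assumes "2 * k \<le> d" "s \<le> d + 1"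
  shows "coeff (antisym_poly d k) (d + 1 - s) = - coeff (antisym_poly d k) s"
proof -
  have "reflect_poly [:-1, 1:] = - [:-1, 1 :: rat:]" "reflect_poly [:1, 1:] = [:1, 1 :: rat:]"
    by (simp_all add: reflect_poly_pCons)
  moreover have "(- p) ^ (2 * k + 1) = - (p ^ (2 * k + 1))" for p :: "rat poly"
    by (rule power_minus_odd) simp
  ultimately have "reflect_poly (antisym_poly d k) = - antisym_poly d k"
    by (simp only: antisym_poly_def reflect_poly_mult reflect_poly_power mult_minus_left)
  then have "coeff (reflect_poly (antisym_poly d k)) s = - coeff (antisym_poly d k) s"
    by simp
  then show ?thesis
    using assms by (simp add: coeff_reflect_poly degree_antisym_poly)
qed

lemma pcompose_power:
  fixes p r :: "'a :: comm_semiring_1 poly"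
  shows "pcompose (p ^ n) r = pcompose p r ^ n"
  by (induction n) (simp_all add: pcompose_1 pcompose_mult)

lemma coeff_one_plus_X_power: "coeff ([:1, 1:] ^ n) k = (of_nat (n choose k) :: rat)"
proof (cases "k \<le> n")
  case False
  then show ?thesis by (simp add: coeff_eq_0 degree_power_eq)
qed (simp add: coeff_linear_poly_power)

text \<open>Both sides are the coefficient of \<open>x ^ (d + 1 - j)\<close> after substituting
  \<open>y = 1 + x\<close>.\<close>

lemma sum_choose_antisym_poly:
  assumes "2 * k \<le> d" "j \<le> d"
  shows "(\<Sum>s\<le>d + 1. coeff (antisym_poly d k) s * of_nat (s choose (d + 1 - j))) =
    of_nat (d - 2 * k choose j) * 2 ^ j"
proof -
  let ?P = "antisym_poly d k"
  have "pcompose ?P [:1, 1:] = (\<Sum>s\<le>d + 1. smult (coeff ?P s) ([:1, 1:] ^ s))"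
    using assms(1) by (simp add: pcompose_altdef poly_altdef degree_map_poly coeff_map_poly degree_antisym_poly del: One_nat_def sum.atMost_Suc)
  then have "(\<Sum>s\<le>d + 1. coeff ?P s * of_nat (s choose (d + 1 - j))) = coeff (pcompose ?P [:1, 1:]) (d + 1 - j)"
    by (simp add: coeff_sum coeff_one_plus_X_power del: sum.atMost_Suc)
  also have "pcompose ?P [:1, 1:] = monom 1 (2 * k + 1) * [:2, 1:] ^ (d - 2 * k)"
    by (simp add: antisym_poly_def pcompose_mult pcompose_power pcompose_pCons monom_altdef del: power_Suc)
  also have "coeff \<dots> (d + 1 - j) = of_nat (d - 2 * k choose j) * 2 ^ j"
  proof (cases "j \<le> d - 2 * k")
    case True
    then have "d + 1 - j - (2 * k + 1) = (d - 2 * k) - j" "2 * k + 1 \<le> d + 1 - j" using assms by auto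
    then show ?thesis
      using True binomial_symmetric[OF True] by (simp add: coeff_monom_mult coeff_linear_poly_power)
  next
    case False
    then show ?thesis using assms by (simp add: coeff_monom_mult)
  qed
  finally show ?thesis .
qed

text \<open>Pair \<open>s\<close> with \<open>d + 1 - s\<close>. For odd \<open>d\<close> the middle
  index is its own partner, and there \<open>g s = - g s\<close> forces
  \<open>g s = 0\<close>.\<close>

lemma sum_antisymmetric:
  fixes g h :: "nat \<Rightarrow> 'a :: linordered_idom"
  assumes "\<And>s. s \<le> d + 1 \<Longrightarrow> g (d + 1 - s) = - g s"
  shows "(\<Sum>s\<le>d + 1. g s * h s) = (\<Sum>i<d div 2 + 1. g (d + 1 - i) * (h (d + 1 - i) - h i))"
proof -
  let ?A = "{..<d div 2 + 1}" and ?B = "(\<lambda>i. d + 1 - i) ` {..<d div 2 + 1}"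
  have "g s * h s = 0" if s: "s \<in> {..d + 1} - (?A \<union> ?B)" for s
  proof -
    have "\<not> d + 1 - s < d div 2 + 1" using s by (auto intro: image_eqI[of _ _ "d + 1 - s"])
    then have "d + 1 - s = s" using s by auto
    then show ?thesis using assms[of s] s by auto
  qed
  then have "(\<Sum>s\<le>d + 1. g s * h s) = (\<Sum>s\<in>?A \<union> ?B. g s * h s)"
    by (intro sum.mono_neutral_right) auto
  also have "\<dots> = (\<Sum>s\<in>?A. g s * h s) + (\<Sum>s\<in>?B. g s * h s)"
    by (rule sum.union_disjoint) auto
  also have "(\<Sum>s\<in>?B. g s * h s) = (\<Sum>i<d div 2 + 1. g (d + 1 - i) * h (d + 1 - i))"
    by (subst sum.reindex) (auto simp: inj_on_def)
  also have "(\<Sum>s\<in>?A. g s * h s) = (\<Sum>i<d div 2 + 1. - (g (d + 1 - i) * h i))"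
    using assms by (intro sum.cong) auto
  finally show ?thesis by (simp add: sum.distrib[symmetric] algebra_simps del: sum.lessThan_Suc)
qed

lemma DS_minor_nonzero_iff:
  assumes "\<And>i j. i < j \<Longrightarrow> j < d div 2 + 1 \<Longrightarrow> c i < c j"
    and "\<And>j. j < d div 2 + 1 \<Longrightarrow> c j \<le> d"
  shows "det (mat (d div 2 + 1) (d div 2 + 1) (\<lambda>(i, j). DS_matrix d $$ (i, c j))) \<noteq> 0 \<longleftrightarrow>
    (\<forall>k<d div 2 + 1. c k + 2 * (d div 2 - k) \<le> d)"
proof -
  define r where "r = d div 2 + 1"
  \<comment> \<open>Reversing the order of the polynomials by \<open>q\<close> makes the Pascal rows
    \<open>m\<close> increasing.\<close>
  define q m where "q k = d div 2 - k" and "m k = d - 2 * q k" for k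
  define S where "S = mat r r (\<lambda>(k, i). coeff (antisym_poly d (q k)) (d + 1 - i))"
  define M where "M c = mat r r (\<lambda>(i, j). DS_matrix d $$ (i, c j))" for c
  have q: "2 * q k \<le> d" for k by (simp add: q_def)
  \<comment> \<open>The columns stay arbitrary here because the identity is used twice: for the
    given columns and for the first \<open>r\<close> ones.\<close>
  have minor: "det S * det (M c) = (\<Prod>j<r. 2 ^ c j) * det (mat r r (\<lambda>(k, j). of_nat (m k choose c j)))"
    if c: "\<And>j. j < r \<Longrightarrow> c j \<le> d" for c
  proof -
    have "S * M c = mat r r (\<lambda>(k, j). 1 * of_nat (m k choose c j) * 2 ^ c j)"
    proof (rule eq_matI, goal_cases)
      case (1 k j)
      then have kj: "k < r" "j < r" by auto
      let ?P = "antisym_poly d (q k)"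
      have "(S * M c) $$ (k, j) = (\<Sum>i<r. coeff ?P (d + 1 - i) *
          (of_nat (d + 1 - i choose (d + 1 - c j)) - of_nat (i choose (d + 1 - c j))))"
        using kj c[OF kj(2)]
        by (simp add: S_def M_def scalar_prod_def atLeast0LessThan DS_matrix_def r_def)
      also have "\<dots> = (\<Sum>s\<le>d + 1. coeff ?P s * of_nat (s choose (d + 1 - c j)))"
        unfolding r_def by (rule sum_antisymmetric[symmetric]) (rule coeff_antisym_poly[OF q])
      finally show ?case
        using kj sum_choose_antisym_poly[OF q c[OF kj(2)]] by (simp add: m_def)
    qed (auto simp: S_def M_def)
    then have "det (S * M c) = (\<Prod>j<r. 2 ^ c j) * det (mat r r (\<lambda>(k, j). of_nat (m k choose c j)))"
      by (simp only: det_mat_scale) simp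
    then show ?thesis
      by (subst (asm) det_mult[of _ r]) (auto simp: S_def M_def)
  qed
  have m: "m i < m j" if "i < j" "j < r" for i j
    using that by (auto simp: m_def q_def r_def)
  have iff: "det S * det (M c) \<noteq> 0 \<longleftrightarrow> (\<forall>k<r. c k \<le> m k)"
    if "\<And>i j. i < j \<Longrightarrow> j < r \<Longrightarrow> c i < c j" "\<And>j. j < r \<Longrightarrow> c j \<le> d" for c
    using det_binomial_nonzero_iff[where 'a = rat, of r m c] m that by (simp add: minor)
  \<comment> \<open>The minor on the first columns is nonzero, so the row transformation is invertible.\<close>
  have "det S \<noteq> 0"
  proof -
    have "k \<le> m k" if "k < r" for k using that unfolding m_def q_def r_def by linarith
    moreover have "j \<le> d" if "j < r" for j using that unfolding r_def by linarith
    ultimately show ?thesis using iff[of id] by auto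
  qed
  with iff[of c] assms show ?thesis
    by (simp add: r_def M_def m_def q_def) (metis Nat.le_diff_conv2 q q_def)
qed

lemma DS_bases_iff:
  assumes "B \<subseteq> {1..d + 1}"
  defines "J \<equiv> {j. j + 1 \<in> B}"
  shows "B \<in> DS_bases d \<longleftrightarrow>
    card J = d div 2 + 1 \<and> (\<forall>k<d div 2 + 1. pick J k + 2 * (d div 2 - k) \<le> d)"
proof -
  have "B = Suc ` J"
    using assms(1) by (auto simp: J_def image_iff) (metis One_nat_def Suc_le_D atLeastAtMost_iff subset_iff)
  then have card: "card B = card J" by (simp add: card_image)
  have Jd: "j \<le> d" if "j \<in> J" for j using assms(1) that by (auto simp: J_def)
  have "det (submatrix (DS_matrix d) UNIV J) \<noteq> 0 \<longleftrightarrow> (\<forall>k<d div 2 + 1. pick J k + 2 * (d div 2 - k) \<le> d)"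
    if "card J = d div 2 + 1"
  proof -
    have J: "{j. j < d + 1 \<and> j \<in> J} = J" using Jd by force
    have "submatrix (DS_matrix d) UNIV J =
        mat (d div 2 + 1) (d div 2 + 1) (\<lambda>(i, j). DS_matrix d $$ (i, pick J j))"
      using that by (simp add: submatrix_def DS_matrix_def J pick_UNIV J[simplified])
    then show ?thesis
      using DS_minor_nonzero_iff[of d "pick J"] pick_mono[of _ J] pick_in_set[of _ J] Jd that by simp
  qed
  with assms(1) card show ?thesis by (auto simp: DS_bases_def J_def)
qed

section \<open>Routings in the Dehn--Sommerville digraph\<close>

lemma DS_verts_iff: "(x, y) \<in> DS_verts d \<longleftrightarrow> x \<le> 0 \<and> - x \<le> y \<and> y - x \<le> int d"
proof -
  have "(x, y) \<in> DS_verts d \<longleftrightarrow> (\<exists>a. x = - a \<and> 0 \<le> a \<and> a \<le> y \<and> a + y \<le> int d)"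
    by (auto simp: DS_verts_def)
  also have "\<dots> \<longleftrightarrow> x \<le> 0 \<and> - x \<le> y \<and> y - x \<le> int d"
    by (auto intro: exI[of _ "- x"])
  finally show ?thesis .
qed

lemma DS_arcs_iff:
  "((x, y), (x', y')) \<in> DS_arcs d \<longleftrightarrow> (x, y) \<in> DS_verts d \<and> (x', y') \<in> DS_verts d \<and>
    (x' = x + 1 \<and> y' = y \<or> x' = x \<and> y' = y + 1)"
proof -
  have "((x, y), (x', y')) \<in> DS_arcs d \<longleftrightarrow> (\<exists>a. x = - a \<and> (- a, y) \<in> DS_verts d \<and> (x', y') \<in> DS_verts d \<and>
    (x' = - a + 1 \<and> y' = y \<or> x' = - a \<and> y' = y + 1))"
    by (auto simp: DS_arcs_def)
  then show ?thesis by (auto intro: exI[of _ "- x"])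
qed

lemma vwalk_arcs_conv_zip: "vwalk_arcs p = zip p (tl p)"
  by (induction p rule: vwalk_arcs.induct) auto

lemma vwalk_conv_nth:
  "vwalk p G \<longleftrightarrow> p \<noteq> [] \<and> (\<forall>i<length p. p ! i \<in> verts G) \<and>
    (\<forall>i. Suc i < length p \<longrightarrow> (p ! i, p ! Suc i) \<in> arcs_ends G)"
proof -
  have "set (vwalk_arcs p) = {(p ! i, p ! Suc i) | i. Suc i < length p}"
    by (auto simp: vwalk_arcs_conv_zip set_zip nth_tl less_diff_conv)
  then show ?thesis by (auto simp: vwalk_def set_conv_nth)
qed

lemma DS_digraph_simps [simp]: "pverts (DS_digraph d) = DS_verts d" "parcs (DS_digraph d) = DS_arcs d"
  by (simp_all add: DS_digraph_def)

lemma DS_sources: "DS_source ` {1..r} = (\<lambda>k. (- int k, int k)) ` {..<r}"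
proof -
  have "{1..r} = Suc ` {..<r}" by (simp add: image_Suc_lessThan)
  then show ?thesis by (simp add: DS_source_def image_image)
qed

lemma DS_sinks:
  assumes "B \<subseteq> {1..}"
  shows "DS_sink ` B = (\<lambda>j. (0, int j)) ` {j. j + 1 \<in> B}"
proof -
  have "B = Suc ` {j. j + 1 \<in> B}"
    using assms by (auto simp: image_iff) (metis One_nat_def Suc_le_D atLeast_iff subset_iff)
  then have "DS_sink ` B = DS_sink ` Suc ` {j. j + 1 \<in> B}" by simp
  then show ?thesis by (simp add: DS_sink_def image_image)
qed

text \<open>Every arc raises \<open>y + x\<close> by one, so \<open>y + x\<close> is the time at which a walk from \<open>(- k, k)\<close>
  visits \<open>(x, y)\<close>. Disjoint paths are hence in different columns at any common time.\<close>

lemma DS_walk_time: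
  assumes "vwalk p (with_proj (DS_digraph d))" "hd p = (- int k, int k)" "t < length p"
  shows "fst (p ! t) + snd (p ! t) = int t"
  using assms(3)
proof (induction t)
  case 0
  then show ?case using assms(2) by (simp add: hd_conv_nth)
next
  case (Suc t)
  then have "(p ! t, p ! Suc t) \<in> DS_arcs d"
    using assms(1) by (simp add: vwalk_conv_nth)
  with Suc show ?case
    by (cases "p ! t"; cases "p ! Suc t") (auto simp: DS_arcs_iff)
qed

lemma DS_routing_of_bounds:
  assumes "finite J" "card J = r" and bound: "\<And>k. k < r \<Longrightarrow> pick J k + 2 * (r - 1 - k) \<le> d"
  shows "\<exists>P. routing (with_proj (DS_digraph d)) ((\<lambda>k. (- int k, int k)) ` {..<r})
    ((\<lambda>j. (0, int j)) ` J) P"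
proof -
  define c where "c = pick J"
  \<comment> \<open>\<open>N t\<close> is the number of east steps made before time
    \<open>t\<close>, and \<open>v k t\<close> is the position of path \<open>k\<close> at that
    time. Path \<open>k\<close> stops at time \<open>c k\<close>, after exactly \<open>k\<close>
    east steps.\<close>
  define N where "N t = card {a \<in> J. a < t}" for t
  define v where "v k t = (int (N t) - int k, int k - int (N t) + int t)" for k t
  define p where "p k = map (v k) [0..<Suc (c k)]" for k
  have cJ: "c k \<in> J" and Nc: "N (c k) = k" if "k < r" for k
    using pick_in_set[of k J] card_pick[of k J] that assms(2) by (auto simp: c_def N_def)
  have N_mono: "N t \<le> N t'" if "t \<le> t'" for t t'
    unfolding N_def using that assms(1) by (intro card_mono) auto
  have N_Suc: "N (Suc t) = N t + (if t \<in> J then 1 else 0)" for t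
  proof -
    have "{a \<in> J. a < Suc t} = {a \<in> J. a < t} \<union> (if t \<in> J then {t} else {})"
      by (auto simp: less_Suc_eq)
    then show ?thesis using assms(1) by (simp add: N_def)
  qed
  have vert: "v k t \<in> DS_verts d" if "k < r" "t \<le> c k" for k t
  proof -
    have Nk: "N t \<le> k" using N_mono[OF that(2)] Nc[OF that(1)] by simp
    \<comment> \<open>\<open>c (N t)\<close> is the first element of \<open>J\<close> not below
      \<open>t\<close>. The bound at \<open>N t\<close> then limits
      \<open>y - x = t + 2 * (k - N t)\<close> by \<open>d\<close>.\<close>
    have "t \<le> c (N t)"
    proof (rule ccontr)
      assume "\<not> t \<le> c (N t)"
      then have "N (Suc (c (N t))) \<le> N t" by (intro N_mono) simp
      then show False using Nc[of "N t"] cJ[of "N t"] Nk that(1) by (simp add: N_Suc)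
    qed
    with bound[of "N t"] Nk that(1) show ?thesis
      by (auto simp: v_def DS_verts_iff c_def)
  qed
  have walk: "vwalk (p k) (with_proj (DS_digraph d))" if "k < r" for k
    unfolding vwalk_conv_nth with_proj_simps DS_digraph_simps
  proof (intro conjI allI impI)
    fix i assume "Suc i < length (p k)"
    then have i: "Suc i \<le> c k" by (simp add: p_def)
    then have "(v k i, v k (Suc i)) \<in> DS_arcs d"
      using vert[OF that, of i] vert[OF that i] by (auto simp: v_def DS_arcs_iff N_Suc)
    moreover have "p k ! i = v k i" "p k ! Suc i = v k (Suc i)"
      using i by (simp_all add: p_def nth_append del: upt_Suc)
    ultimately show "(p k ! i, p k ! Suc i) \<in> DS_arcs d" by simp
  next
    fix i assume "i < length (p k)"
    then show "p k ! i \<in> DS_verts d" using vert[OF that, of i] by (simp add: p_def del: upt_Suc)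
  qed (simp add: p_def)
  \<comment> \<open>The coordinate sum of \<open>v k t\<close> is \<open>t\<close>, and then the
    first coordinate determines \<open>k\<close>. This gives both distinct vertices on a path and
    disjointness of the paths.\<close>
  have v_inj: "t = t' \<and> k = k'" if "v k t = v k' t'" for k t k' t'
  proof -
    have "t = t'" using that by (auto simp: v_def)
    then show ?thesis using that by (auto simp: v_def)
  qed
  have dist: "distinct (p k)" for k
    by (auto simp: p_def distinct_map inj_on_def dest: v_inj)
  have hd: "hd (p k) = (- int k, int k)" for k
    by (simp add: p_def hd_map v_def N_def del: upt_Suc)
  have last: "last (p k) = (0, int (c k))" if "k < r" for k
    using Nc[OF that] by (simp add: p_def v_def)
  have disj: "set (p k) \<inter> set (p k') = {}" if "k \<noteq> k'" for k k'
    using that by (auto simp: p_def dest!: v_inj simp del: upt_Suc)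
  have "c ` {..<r} = J"
  proof
    show "J \<subseteq> c ` {..<r}"
    proof
      fix j assume j: "j \<in> J"
      then have "N j < r"
        unfolding N_def assms(2)[symmetric] using assms(1) by (intro psubset_card_mono) auto
      then show "j \<in> c ` {..<r}" using pick_card_in_set[OF j] by (auto simp: N_def c_def intro!: image_eqI)
    qed
  qed (use cJ in auto)
  then have "(\<lambda>k. last (p k)) ` {..<r} = (\<lambda>j. (0, int j)) ` J"
    using last by (force simp: image_iff)
  \<comment> \<open>\<open>nat (snd s)\<close> recovers \<open>k\<close> from the source
    \<open>(- k, k)\<close>.\<close>
  then have "routing (with_proj (DS_digraph d)) ((\<lambda>k. (- int k, int k)) ` {..<r})
    ((\<lambda>j. (0, int j)) ` J) (\<lambda>s. p (nat (snd s)))"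
    using walk dist hd disj by (simp add: routing_def image_image vpath_def)
  then show ?thesis by blast
qed

lemma DS_bounds_of_routing:
  assumes "routing (with_proj (DS_digraph d)) ((\<lambda>k. (- int k, int k)) ` {..<r})
    ((\<lambda>j. (0, int j)) ` J) P"
  shows "card J = r \<and> (\<forall>k<r. pick J k + 2 * (r - 1 - k) \<le> d)"
proof -
  define p where "p k = P (- int k, int k)" for k
  \<comment> \<open>\<open>L k\<close> counts the arcs of path \<open>k\<close>. It is the arrival
    time and, as the sink has \<open>x = 0\<close>, also the height of the sink.\<close>
  define L where "L k = length (p k) - 1" for k
  have walk: "vwalk (p k) (with_proj (DS_digraph d))" and hd: "hd (p k) = (- int k, int k)"
    and ne: "p k \<noteq> []" if "k < r" for k
    using assms that by (auto simp: routing_def vpath_def p_def vwalk_def)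
  have disj: "set (p k) \<inter> set (p k') = {}" if "k < r" "k' < r" "k \<noteq> k'" for k k'
  proof -
    let ?S = "(\<lambda>k. (- int k, int k)) ` {..<r}"
    have "\<forall>s\<in>?S. \<forall>s'\<in>?S. s \<noteq> s' \<longrightarrow> set (P s) \<inter> set (P s') = {}"
      using assms unfolding routing_def by (elim conjE)
    from this[rule_format, of "(- int k, int k)" "(- int k', int k')"] that show ?thesis
      by (simp add: p_def)
  qed
  have ends: "(\<lambda>k. last (p k)) ` {..<r} = (\<lambda>j. (0, int j)) ` J"
    using assms by (simp add: routing_def p_def image_image)
  have len: "t < length (p k) \<longleftrightarrow> t \<le> L k" if "k < r" for k t
    using ne[OF that] by (cases "p k") (auto simp: L_def)
  have time: "fst (p k ! t) + snd (p k ! t) = int t" if "k < r" "t \<le> L k" for k t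
    using DS_walk_time[OF walk hd] that len by blast
  have vert: "fst (p k ! t) \<le> 0 \<and> snd (p k ! t) - fst (p k ! t) \<le> int d" if "k < r" "t \<le> L k" for k t
  proof -
    have "p k ! t \<in> DS_verts d"
      using walk[OF that(1)] len that by (simp add: vwalk_conv_nth)
    then show ?thesis by (cases "p k ! t") (simp add: DS_verts_iff)
  qed
  have step: "fst (p k ! Suc t) = fst (p k ! t) \<or> fst (p k ! Suc t) = fst (p k ! t) + 1"
    if "k < r" "Suc t \<le> L k" for k t
  proof -
    have "(p k ! t, p k ! Suc t) \<in> DS_arcs d"
      using walk[OF that(1)] len that by (simp add: vwalk_conv_nth)
    then show ?thesis by (cases "p k ! t"; cases "p k ! Suc t") (auto simp: DS_arcs_iff)
  qed
  \<comment> \<open>Horizontal gaps change by at most one per step, so an overtaking would first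
    make the columns equal; at a common time that means a common vertex.\<close>
  have order: "fst (p k' ! t) < fst (p k ! t)" if "k < k'" "k' < r" "t \<le> L k" "t \<le> L k'" for k k' t
    using that(3,4)
  proof (induction t)
    case 0
    then show ?case using hd[of k] hd[of k'] ne[of k] ne[of k'] that by (simp add: hd_conv_nth)
  next
    case (Suc t)
    have "p k ! Suc t \<in> set (p k)" "p k' ! Suc t \<in> set (p k')"
      using len[of k "Suc t"] len[of k' "Suc t"] Suc.prems that by auto
    then have "p k ! Suc t \<noteq> p k' ! Suc t"
      using disj[of k k'] that by (metis disjoint_iff less_trans less_irrefl)
    then have "fst (p k ! Suc t) \<noteq> fst (p k' ! Suc t)"
      using time[of k "Suc t"] time[of k' "Suc t"] Suc.prems that by (auto simp: prod_eq_iff)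
    then show ?case
      using step[of k t] step[of k' t] Suc that by auto
  qed
  have at_L: "p k ! L k = (0, int (L k))" if "k < r" for k
  proof -
    have "p k ! L k = last (p k)" using ne[OF that] by (simp add: L_def last_conv_nth)
    moreover have "last (p k) \<in> (\<lambda>j. (0, int j)) ` J" using ends that by blast
    ultimately show ?thesis using time[OF that, of "L k"] by auto
  qed
  \<comment> \<open>If path \<open>k\<close> were still present when path \<open>k'\<close> arrives
    at \<open>x = 0\<close>, it would have to lie strictly east of that column, outside the
    digraph.\<close>
  have L_less: "L k < L k'" if "k < k'" "k' < r" for k k'
    using order[OF that, of "L k'"] at_L[OF that(2)] vert[of k "L k'"] that by fastforce
  have "last (p k) = (0, int (L k))" if "k < r" for k
    using at_L[OF that] ne[OF that] by (simp add: L_def last_conv_nth)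
  then have "(\<lambda>j. (0 :: int, int j)) ` J = (\<lambda>j. (0, int j)) ` L ` {..<r}"
    unfolding ends[symmetric] by (auto simp: image_image)
  then have J: "J = L ` {..<r}"
    by (subst (asm) inj_image_eq_iff) (auto simp: inj_def)
  have L_less_iff: "L k < L k' \<longleftrightarrow> k < k'" if "k < r" "k' < r" for k k'
    using L_less[of k k'] L_less[of k' k] that by (cases k k' rule: linorder_cases) auto
  have inj: "inj_on L {..<r}"
    using L_less_iff by (intro inj_onI) (metis lessThan_iff less_irrefl linorder_neqE_nat)
  have pick: "pick J k = L k" if "k < r" for k
  proof -
    have "{a \<in> J. a < L k} = L ` {..<k}" using that by (auto simp: J L_less_iff)
    then have "card {a \<in> J. a < L k} = k"
      using card_image[OF inj_on_subset[OF inj], of "{..<k}"] that by auto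
    then show ?thesis using pick_card_in_set[of "L k" J] J that by auto
  qed
  have "L k + 2 * (r - 1 - k) \<le> d" if k: "k < r" for k
  proof -
    \<comment> \<open>At time \<open>L k\<close> path \<open>k\<close> is at \<open>x = 0\<close>
      and each later path is at least one column further west. For the last path,
      \<open>y - x = L k - 2 * x \<le> d\<close> yields the bound.\<close>
    have "fst (p k' ! L k) \<le> - int (k' - k)" if "k \<le> k'" "k' < r" for k'
      using that
    proof (induction k' rule: dec_induct)
      case base
      then show ?case using at_L[OF k] by simp
    next
      case (step k')
      have "L k \<le> L k'" using step L_less[of k k'] by (cases "k = k'") auto
      then have "fst (p (Suc k') ! L k) < fst (p k' ! L k)"
        using step L_less[of k' "Suc k'"] by (intro order) auto
      with step show ?case by simp
    qed
    from this[of "r - 1"] have "fst (p (r - 1) ! L k) \<le> - int (r - 1 - k)" using k by simp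
    moreover have "L k \<le> L (r - 1)"
    proof (cases "k = r - 1")
      case False
      then have "k < r - 1" using k by linarith
      then show ?thesis using L_less[of k "r - 1"] k by simp
    qed simp
    ultimately show ?thesis
      using time[of "r - 1" "L k"] vert[of "r - 1" "L k"] k by auto
  qed
  with pick show ?thesis using card_image[OF inj] by (simp add: J)
qed

theorem theorem2p12:
  fixes d r :: nat and B :: "nat set"
  assumes "r = nat \<lceil>(real d + 1) / 2\<rceil>"
    and "B \<subseteq> {1..d + 1}"
  shows "B \<in> DS_bases d \<longleftrightarrow>
    (\<exists>P. routing (with_proj (DS_digraph d)) (DS_source ` {1..r}) (DS_sink ` B) P)"
proof -
  define J where "J = {j. j + 1 \<in> B}"
  have "J \<subseteq> {..d}" using assms(2) by (auto simp: J_def)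
  then have "finite J" by (rule finite_subset) simp
  have r: "r = d div 2 + 1"
  proof -
    have "\<lceil>(real d + 1) / 2\<rceil> = int (d div 2) + 1"
      by (rule ceiling_unique; cases "even d"; auto elim!: evenE oddE)
    then show ?thesis using assms(1) by simp
  qed
  have "DS_sink ` B = (\<lambda>j. (0, int j)) ` J"
    unfolding J_def using assms(2) by (intro DS_sinks) auto
  then have "(\<exists>P. routing (with_proj (DS_digraph d)) (DS_source ` {1..r}) (DS_sink ` B) P) \<longleftrightarrow>
      card J = r \<and> (\<forall>k<r. pick J k + 2 * (r - 1 - k) \<le> d)"
    using DS_routing_of_bounds[OF \<open>finite J\<close>, of r d] DS_bounds_of_routing[of d r J]
    unfolding DS_sources by metis
  also have "\<dots> \<longleftrightarrow> B \<in> DS_bases d"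
    using DS_bases_iff[OF assms(2)] by (simp add: J_def r)
  finally show ?thesis by blast
qed

end
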